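(* Let $\Bbbk$ be a field of characteristic zero. (1) For every ternary $\Bbbk$-algebra $A$ satisfying the identity $w_5^{(3)}=0$, the associative algebra $L(A)$ generated by all left multiplications $l_{a,b}\colon x\mapsto (a\,b\,x)$ ($a,b\in A$) and the associative algebra $R(A)$ generated by all right multiplications $r_{a,b}\colon x\mapsto (x\,a\,b)$ ($a,b\in A$) are nilpotent of index $4$, that is, $L(A)^4=0$ and $R(A)^4=0$. Moreover, the index $4$ cannot be lowered in general: there exists a ternary algebra $A$ satisfying $w_5^{(3)}=0$ with $L(A)^3\ne 0$, and there exists a ternary algebra $A$ satisfying $w_5^{(3)}=0$ with $R(A)^3\neq 0$. (2) In general, the algebra $U(A)$ generated by both left and right multiplications is not nilpotent: there exists a ternary algebra $A$ satisfying $w_5^{(3)}=0$ such that $U(A)^N\ne 0$ for all $N\ge 1$.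
   Context: A ternary algebra is a $\Bbbk$-vector space $A$ with a trilinear operation $A\otimes A\otimes A\to A$, $(a_1,a_2,a_3)\mapsto (a_1\,a_2\,a_3)$, with no symmetry or associativity assumed. For odd $n$, $w_n^{(3)}(a_1,\ldots,a_n)$ is the sum of all distinct multilinear terms of degree $n$ obtained by iterating the ternary operation with the arguments $a_1,\ldots,a_n$ placed in the natural order. In particular $w_5^{(3)}(a_1,\ldots,a_5)=((a_1a_2a_3)a_4a_5)+(a_1(a_2a_3a_4)a_5)+(a_1a_2(a_3a_4a_5))$. "$A$ satisfies $w_n^{(3)}=0$" means that this operation vanishes for all arguments from $A$. $L(A)$, $R(A)$, $U(A)$ denote the (non-unital) associative subalgebras of $\operatorname{End}_{\Bbbk}(A)$ generated respectively by all $l_{a,b}$, by all $r_{a,b}$, and by all $l_{a,b}$ and $r_{a,b}$ together. For a non-unital associative algebra $B$, $B^N$ is the span of all products of $N$ elements of $B$; $B$ is nilpotent if $B^N=0$ for some $N$, and nilpotent of index $N$ if $B^N=0$. *)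

theory Defs
  imports Complex_Main "HOL-Library.Function_Algebras" "HOL-Library.Poly_Mapping"
begin

locale ternary_algebra = vector_space scale
  for scale :: "'k::field \<Rightarrow> 'a::ab_group_add \<Rightarrow> 'a" +
  fixes op3 :: "'a \<Rightarrow> 'a \<Rightarrow> 'a \<Rightarrow> 'a"
  assumes linear_1: "Vector_Spaces.linear scale scale (\<lambda>x. op3 x b c)"
    and linear_2: "Vector_Spaces.linear scale scale (\<lambda>x. op3 a x c)"
    and linear_3: "Vector_Spaces.linear scale scale (\<lambda>x. op3 a b x)"
begin

text \<open>The maps from the algebra to itself form a vector space under pointwise addition
  (from \<^theory>\<open>HOL-Library.Function_Algebras\<close>) and pointwise scaling. The
  multiplication of endomorphisms is composition, not the pointwise product of that theory.\<close>

sublocale endo: vector_space "\<lambda>c (f :: 'a \<Rightarrow> 'a) x. scale c (f x)"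
  by unfold_locales (auto simp: fun_eq_iff scale_right_distrib scale_left_distrib)

definition End :: "('a \<Rightarrow> 'a) set" where
  "End = {f. Vector_Spaces.linear scale scale f}"

definition End_subalgebra :: "('a \<Rightarrow> 'a) set \<Rightarrow> bool" where
  "End_subalgebra B \<longleftrightarrow> B \<subseteq> End \<and> endo.subspace B \<and> (\<forall>f\<in>B. \<forall>g\<in>B. f \<circ> g \<in> B)"

definition generated_subalgebra :: "('a \<Rightarrow> 'a) set \<Rightarrow> ('a \<Rightarrow> 'a) set" where
  "generated_subalgebra G = End_subalgebra hull G"

definition lmult :: "'a \<Rightarrow> 'a \<Rightarrow> 'a \<Rightarrow> 'a" where
  "lmult a b = (\<lambda>x. op3 a b x)"

definition rmult :: "'a \<Rightarrow> 'a \<Rightarrow> 'a \<Rightarrow> 'a" where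
  "rmult a b = (\<lambda>x. op3 x a b)"

definition L_alg :: "('a \<Rightarrow> 'a) set" where
  "L_alg = generated_subalgebra {lmult a b | a b. True}"

definition R_alg :: "('a \<Rightarrow> 'a) set" where
  "R_alg = generated_subalgebra {rmult a b | a b. True}"

definition U_alg :: "('a \<Rightarrow> 'a) set" where
  "U_alg = generated_subalgebra ({lmult a b | a b. True} \<union> {rmult a b | a b. True})"

text \<open>Meaningful for \<open>N \<ge> 1\<close> only: the empty product is the identity map, which
  need not belong to \<open>B\<close>.\<close>

definition alg_power :: "('a \<Rightarrow> 'a) set \<Rightarrow> nat \<Rightarrow> ('a \<Rightarrow> 'a) set" where
  "alg_power B N = endo.span {foldr (\<circ>) fs id | fs. length fs = N \<and> set fs \<subseteq> B}"

definition w5 :: "'a \<Rightarrow> 'a \<Rightarrow> 'a \<Rightarrow> 'a \<Rightarrow> 'a \<Rightarrow> 'a" where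
  "w5 a1 a2 a3 a4 a5 =
     op3 (op3 a1 a2 a3) a4 a5 + op3 a1 (op3 a2 a3 a4) a5 + op3 a1 a2 (op3 a3 a4 a5)"

definition satisfies_w5 :: bool where
  "satisfies_w5 \<longleftrightarrow> (\<forall>a1 a2 a3 a4 a5. w5 a1 a2 a3 a4 a5 = 0)"

text \<open>Sanity check: the hull is itself a subalgebra, so it is the smallest one containing
  the generators.\<close>

lemma End_subalgebra_generated:
  assumes "G \<subseteq> End"
  shows "End_subalgebra (generated_subalgebra G)"
proof -
  interpret vector_space_pair scale scale ..
  have "endo.subspace End"
    unfolding endo.subspace_def End_def
    by (simp add: zero_fun_def plus_fun_def linear_zero linear_compose_add
        linear_compose_scale_right)
  moreover have "f \<circ> g \<in> End" if "f \<in> End" "g \<in> End" for f g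
    using Vector_Spaces.linear_compose[of scale scale g scale f] that by (simp add: End_def)
  ultimately have "End_subalgebra End"
    by (simp add: End_subalgebra_def)
  then have "generated_subalgebra G \<subseteq> End"
    using assms by (auto simp: generated_subalgebra_def hull_def)
  moreover have "endo.subspace (generated_subalgebra G)"
    unfolding generated_subalgebra_def hull_def
    by (rule endo.subspace_Inter) (simp add: End_subalgebra_def)
  moreover have "f \<circ> g \<in> generated_subalgebra G"
    if "f \<in> generated_subalgebra G" "g \<in> generated_subalgebra G" for f g
    using that by (simp add: generated_subalgebra_def hull_def End_subalgebra_def)
  ultimately show ?thesis
    by (simp add: End_subalgebra_def)
qed

end

end

theory Submission
  imports Defs
begin

text \<open>Read as an identity of operators on the last argument, $w_5 = 0$ says
  $l_{a,b} l_{c,d} = - l_{(abc),d} - l_{a,(bcd)}$. Expanding $l_{a,b} l_{c,d} l_{e,f}$ in the two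
  possible ways gives $2 l_{(ab(cde)),f} = 2 l_{a,((bcd)ef)}$, which turns either expansion into
  $l_{a,b} l_{c,d} l_{e,f} = l_{(abc),(def)}$. Contracting the first, the middle or the last pair of
  factors of a product $P$ of four left multiplications then yields $P = X$, $P = - X - Y$ and
  $P = Y$, so $3 P = 0$. Right multiplications are the left multiplications of the opposite
  algebra.

  For the algebra with non-nilpotent $U(A)$, take an algebra spanned by $a$ and a two-dimensional
  space $V$ in which the only nonzero products have two arguments $a$ and one in $V$. With
  $l v = (aav)$, $m v = (ava)$ and $r v = (vaa)$, the identity amounts to $l^2 = r^2 = 0$,
  $lm + ml = rm + mr = 0$ and $lr + rl = - m^2$, and this is solved by the matrices $l = E_{12}$,
  $r = - E_{21}$, $m = E_{11} - E_{22}$, for which $lr = - E_{11}$.\<close>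

section \<open>Nilpotency of the left and right multiplication algebras\<close>

context ternary_algebra
begin

section \<open>Trilinearity and the opposite algebra\<close>

lemma op3_add:
  "op3 (x + y) b c = op3 x b c + op3 y b c"
  "op3 a (x + y) c = op3 a x c + op3 a y c"
  "op3 a b (x + y) = op3 a b x + op3 a b y"
  using linear_1 linear_2 linear_3
  by (simp_all add: Vector_Spaces.linear_def module_hom_def module_hom_axioms_def)

lemma op3_scale:
  "op3 (scale r x) b c = scale r (op3 x b c)"
  "op3 a (scale r x) c = scale r (op3 a x c)"
  "op3 a b (scale r x) = scale r (op3 a b x)"
  using linear_1 linear_2 linear_3
  by (simp_all add: Vector_Spaces.linear_def module_hom_def module_hom_axioms_def)

lemma op3_minus:
  "op3 (- x) b c = - op3 x b c"
  "op3 a (- x) c = - op3 a x c"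
  "op3 a b (- x) = - op3 a b x"
  by (simp_all add: op3_scale[where r = "- 1", simplified])

lemma op3_diff:
  "op3 (x - y) b c = op3 x b c - op3 y b c"
  "op3 a (x - y) c = op3 a x c - op3 a y c"
  "op3 a b (x - y) = op3 a b x - op3 a b y"
  unfolding diff_conv_add_uminus op3_add op3_minus by simp_all

text \<open>Reversing the arguments exchanges left and right multiplications and turns
  \<open>w5\<close> into \<open>w5\<close> read backwards, so results on \<open>L_alg\<close> carry
  over to \<open>R_alg\<close>.\<close>

lemma opposite: "ternary_algebra scale (\<lambda>x y z. op3 z y x)"
  by (intro ternary_algebra.intro ternary_algebra_axioms.intro vector_space_axioms
      linear_1 linear_2 linear_3)

lemma satisfies_w5_opposite:
  assumes satisfies_w5
  shows "ternary_algebra.satisfies_w5 (\<lambda>x y z. op3 z y x)"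
proof -
  interpret opp: ternary_algebra scale "\<lambda>x y z. op3 z y x" by (rule opposite)
  have "opp.w5 a1 a2 a3 a4 a5 = w5 a5 a4 a3 a2 a1" for a1 a2 a3 a4 a5
    unfolding opp.w5_def w5_def by (simp only: add_ac)
  then show ?thesis
    using assms by (simp add: opp.satisfies_w5_def satisfies_w5_def)
qed

lemma L_alg_opposite: "ternary_algebra.L_alg scale (\<lambda>x y z. op3 z y x) = R_alg"
proof -
  interpret opp: ternary_algebra scale "\<lambda>x y z. op3 z y x" by (rule opposite)
  have "{opp.lmult a b |a b. True} = {rmult a b |a b. True}"
    unfolding opp.lmult_def rmult_def by blast
  then show ?thesis
    by (simp add: opp.L_alg_def R_alg_def)
qed

lemma generated_subalgebra_incl: "f \<in> G \<Longrightarrow> f \<in> generated_subalgebra G"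
  unfolding generated_subalgebra_def by (rule hull_inc)

lemma generated_subalgebra_comp:
  "f \<in> generated_subalgebra G \<Longrightarrow> g \<in> generated_subalgebra G
    \<Longrightarrow> f \<circ> g \<in> generated_subalgebra G"
  by (simp add: generated_subalgebra_def hull_def End_subalgebra_def)

lemma alg_power_nonzero:
  assumes "set fs \<subseteq> B" and "length fs = N" and "foldr (\<circ>) fs id v \<noteq> 0"
  shows "alg_power B N \<noteq> {0}"
proof -
  have "foldr (\<circ>) fs id \<in> alg_power B N"
    unfolding alg_power_def using assms(1,2) by (intro endo.span_base) blast
  moreover have "foldr (\<circ>) fs id \<noteq> 0"
    using assms(3) by (auto simp: zero_fun_def)
  ultimately show ?thesis by blast
qed

end

section \<open>Products of left multiplications in characteristic zero\<close>

locale w5_algebra = ternary_algebra scale op3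
  for scale :: "'k::field_char_0 \<Rightarrow> 'a::ab_group_add \<Rightarrow> 'a" and op3 +
  assumes w5: satisfies_w5
begin

lemma left_mult_2:
  "op3 a b (op3 c d x) = - op3 (op3 a b c) d x - op3 a (op3 b c d) x"
proof -
  have "op3 (op3 a b c) d x + op3 a (op3 b c d) x + op3 a b (op3 c d x) = 0"
    using w5 by (simp add: satisfies_w5_def w5_def)
  then show ?thesis
    by (metis add_eq_0_iff minus_add_distrib diff_conv_add_uminus)
qed

lemma left_mult_shift:
  "op3 (op3 a b (op3 c d e)) f x = op3 a (op3 (op3 b c d) e f) x"
proof -
  let ?X = "op3 (op3 a b (op3 c d e)) f x" and ?Y = "op3 a (op3 (op3 b c d) e f) x"
  let ?P = "op3 a b (op3 c d (op3 e f x))" and ?Z = "op3 (op3 a b c) (op3 d e f) x"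
  let ?S1 = "op3 (op3 (op3 a b c) d e) f x" and ?T1 = "op3 (op3 a (op3 b c d) e) f x"
  let ?S2 = "op3 a (op3 b (op3 c d e) f) x" and ?T2 = "op3 a (op3 b c (op3 d e f)) x"
  have ST1: "?S1 + ?T1 = - ?X"
    by (simp add: left_mult_2[of a b c d e] op3_diff op3_minus)
  \<comment> \<open>Contract the first two factors, then each result with the third;
    \<open>ST1\<close> is \<open>w5\<close> inside the first slot.\<close>
  have "?P = (?S1 + ?T1) + ?Z + ?Y"
    unfolding left_mult_2[of a b c d "op3 e f x"]
    unfolding left_mult_2[of _ _ e f x]
    by (simp add: algebra_simps)
  then have 1: "?P = ?Z + ?Y - ?X"
    unfolding ST1 by simp
  have ST2: "?S2 + ?T2 = - ?Y"
    by (simp add: left_mult_2[of b c d e f] op3_diff op3_minus)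
  \<comment> \<open>Now the last two factors are contracted first; \<open>ST2\<close> is
    \<open>w5\<close> inside the second slot.\<close>
  have "?P = (?S2 + ?T2) + ?Z + ?X"
    by (simp add: left_mult_2[of c d e f x] left_mult_2[of a b _ _ x] op3_diff op3_minus)
  then have 2: "?P = ?Z + ?X - ?Y"
    unfolding ST2 by simp
  have "scale 2 (?X - ?Y) = (?X - ?Y) + (?X - ?Y)"
    using scale_left_distrib[of 1 1 "?X - ?Y"] by simp
  also have "\<dots> = (?Z + ?X - ?Y) - (?Z + ?Y - ?X)"
    by (simp add: algebra_simps)
  also have "\<dots> = 0"
    unfolding 1[symmetric] 2[symmetric] by simp
  finally show ?thesis
    by simp
qed

lemma left_mult_3:
  "op3 a b (op3 c d (op3 e f x)) = op3 (op3 a b c) (op3 d e f) x"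
proof -
  let ?X = "op3 (op3 a b (op3 c d e)) f x" and ?Z = "op3 (op3 a b c) (op3 d e f) x"
  let ?S = "op3 a (op3 b (op3 c d e) f) x" and ?T = "op3 a (op3 b c (op3 d e f)) x"
  have ST: "?S + ?T = - ?X"
    by (simp add: left_mult_2[of b c d e f] left_mult_shift[of a b c d e f x] op3_diff op3_minus)
  have "op3 a b (op3 c d (op3 e f x)) = ?X + (?S + ?T) + ?Z"
    by (simp add: left_mult_2[of c d e f x] left_mult_2[of a b _ _ x] op3_diff op3_minus)
  then show ?thesis
    unfolding ST by simp
qed

lemma left_mult_4: "op3 a b (op3 c d (op3 e f (op3 g h x))) = 0"
proof -
  let ?P = "op3 a b (op3 c d (op3 e f (op3 g h x)))"
  let ?X = "op3 (op3 a b (op3 c d e)) (op3 f g h) x"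
  let ?Y = "op3 (op3 a b c) (op3 (op3 d e f) g h) x"
  \<comment> \<open>The two terms from the contraction differ only in the first slot, where
    \<open>w5\<close> merges them; in \<open>last\<close> the same happens in the second
    slot.\<close>
  have first: "?P = ?X"
    unfolding left_mult_2[of a b c d "op3 e f (op3 g h x)"]
    unfolding left_mult_3
    by (simp add: left_mult_2[of a b c d e] op3_diff op3_minus)
  have middle: "?P = - ?X - ?Y"
    unfolding left_mult_2[of c d e f "op3 g h x"] op3_diff op3_minus
    unfolding left_mult_3 ..
  have last: "?P = ?Y"
    by (simp add: left_mult_2[of e f g h x] left_mult_3 left_mult_2[of d e f g h]
        op3_diff op3_minus)
  have "scale 3 ?P = ?P + ?P + ?P"
    using scale_left_distrib[of 2 1 ?P] scale_left_distrib[of 1 1 ?P] by simp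
  also have "\<dots> = (- ?X - ?Y) + ?X + ?Y"
    using first middle last by metis
  also have "\<dots> = 0" by simp
  finally show ?thesis by simp
qed

text \<open>By \<open>left_mult_2\<close> the span of the generators is already closed under
  composition, so products in \<open>L_alg\<close> need only be tested on generators.\<close>

lemma L_alg_subset_span: "L_alg \<subseteq> endo.span {lmult a b |a b. True}"
proof -
  let ?G = "{lmult a b |a b. True}"
  have G: "?G \<subseteq> End"
    using linear_3 by (auto simp: End_def lmult_def)
  have "endo.span ?G \<subseteq> generated_subalgebra ?G"
    using End_subalgebra_generated[OF G]
    by (intro endo.span_minimal) (auto simp: End_subalgebra_def intro: generated_subalgebra_incl)
  then have End: "endo.span ?G \<subseteq> End"
    using End_subalgebra_generated[OF G] by (auto simp: End_subalgebra_def)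
  have "lmult a b \<circ> lmult c d = - lmult (op3 a b c) d - lmult a (op3 b c d)" for a b c d
    by (auto simp: fun_eq_iff lmult_def left_mult_2)
  then have gen_gen: "lmult a b \<circ> lmult c d \<in> endo.span ?G" for a b c d
    by (auto intro!: endo.span_diff endo.span_neg intro: endo.span_base)
  have gen_span: "lmult a b \<circ> g \<in> endo.span ?G" if "g \<in> endo.span ?G" for a b g
    using that
  proof (induction rule: endo.span_induct)
    case base
    show ?case
    proof (rule endo.subspaceI)
      show "0 \<in> {g. lmult a b \<circ> g \<in> endo.span ?G}"
        using endo.span_zero[of ?G] op3_scale(3)[of a b 0 0]
        by (simp add: lmult_def comp_def zero_fun_def)
    next
      fix f g assume "f \<in> {g. lmult a b \<circ> g \<in> endo.span ?G}"
        "g \<in> {g. lmult a b \<circ> g \<in> endo.span ?G}"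
      then show "f + g \<in> {g. lmult a b \<circ> g \<in> endo.span ?G}"
        using endo.span_add[of "lmult a b \<circ> f" ?G "lmult a b \<circ> g"]
        by (simp add: lmult_def comp_def plus_fun_def op3_add)
    next
      fix c g assume "g \<in> {g. lmult a b \<circ> g \<in> endo.span ?G}"
      then show "(\<lambda>x. scale c (g x)) \<in> {g. lmult a b \<circ> g \<in> endo.span ?G}"
        using endo.span_scale[of "lmult a b \<circ> g" ?G c]
        by (simp add: lmult_def comp_def op3_scale)
    qed
  next
    case (step g)
    then show ?case using gen_gen by blast
  qed
  have "f \<circ> g \<in> endo.span ?G" if "f \<in> endo.span ?G" "g \<in> endo.span ?G" for f g
    using that(1)
  proof (induction rule: endo.span_induct)
    case base
    show ?case
    proof (rule endo.subspaceI)
      show "0 \<in> {f. f \<circ> g \<in> endo.span ?G}"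
        using endo.span_zero[of ?G] by (simp add: comp_def zero_fun_def)
    next
      fix f h assume "f \<in> {f. f \<circ> g \<in> endo.span ?G}" "h \<in> {f. f \<circ> g \<in> endo.span ?G}"
      then show "f + h \<in> {f. f \<circ> g \<in> endo.span ?G}"
        using endo.span_add[of "f \<circ> g" ?G "h \<circ> g"]
        by (simp add: comp_def plus_fun_def)
    next
      fix c f assume "f \<in> {f. f \<circ> g \<in> endo.span ?G}"
      then show "(\<lambda>x. scale c (f x)) \<in> {f. f \<circ> g \<in> endo.span ?G}"
        using endo.span_scale[of "f \<circ> g" ?G c] by (simp add: comp_def)
    qed
  next
    case (step f)
    then show ?case using gen_span that(2) by blast
  qed
  then have "End_subalgebra (endo.span ?G)"
    using End by (simp add: End_subalgebra_def endo.subspace_span)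
  then show ?thesis
    unfolding L_alg_def generated_subalgebra_def
    by (intro hull_minimal endo.span_superset)
qed

text \<open>The condition is linear in \<open>f\<close>. In use, \<open>T\<close> is the composite
  of the left multiplications standing before \<open>f\<close>.\<close>

lemma L_alg_induct:
  assumes "f \<in> L_alg"
    and "\<And>x y. T (x + y) = T x + T y" and "\<And>c x. T (scale c x) = scale c (T x)"
    and "\<And>a b. T (op3 a b y) = 0"
  shows "T (f y) = 0"
proof -
  have "f \<in> endo.span {lmult a b |a b. True}"
    using assms(1) L_alg_subset_span by blast
  then show ?thesis
  proof (induction rule: endo.span_induct)
    case base
    have "T 0 = 0" using assms(3)[of 0 0] by simp
    then show ?case by (auto intro!: endo.subspaceI simp: assms(2,3))
  next
    case (step f)
    then show ?case using assms(4) by (auto simp: lmult_def)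
  qed
qed

lemma L_alg_comp_4:
  assumes "f1 \<in> L_alg" "f2 \<in> L_alg" "f3 \<in> L_alg" "f4 \<in> L_alg"
  shows "f1 (f2 (f3 (f4 x))) = 0"
proof -
  \<comment> \<open>Generators are replaced by arbitrary elements one factor at a time, from the
    innermost outwards.\<close>
  have "op3 a b (op3 c d (op3 e f (f4 x))) = 0" for a b c d e f
    by (rule L_alg_induct[OF assms(4), where T = "\<lambda>z. op3 a b (op3 c d (op3 e f z))"])
      (simp_all add: op3_add op3_scale left_mult_4)
  then have "op3 a b (op3 c d (f3 (f4 x))) = 0" for a b c d
    by (rule L_alg_induct[OF assms(3), where T = "\<lambda>z. op3 a b (op3 c d z)", rotated 2])
      (simp_all add: op3_add op3_scale)
  then have "op3 a b (f2 (f3 (f4 x))) = 0" for a b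
    by (rule L_alg_induct[OF assms(2), where T = "\<lambda>z. op3 a b z", rotated 2])
      (simp_all add: op3_add op3_scale)
  then show ?thesis
    by (rule L_alg_induct[OF assms(1), where T = "\<lambda>z. z", rotated 2]) simp_all
qed

lemma alg_power_L_alg: "alg_power L_alg 4 = {0}"
proof -
  have "foldr (\<circ>) fs id = 0" if "length fs = 4" "set fs \<subseteq> L_alg" for fs
  proof -
    obtain f1 f2 f3 f4 where "fs = [f1, f2, f3, f4]"
      using \<open>length fs = 4\<close> by (auto simp: numeral_eq_Suc length_Suc_conv)
    then show ?thesis
      using that(2) by (simp add: fun_eq_iff L_alg_comp_4)
  qed
  then have "alg_power L_alg 4 \<subseteq> {0}"
    unfolding alg_power_def by (intro endo.span_minimal endo.subspace_single_0) auto
  moreover have "0 \<in> alg_power L_alg 4"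
    unfolding alg_power_def by (rule endo.span_zero)
  ultimately show ?thesis by auto
qed

end

text \<open>\<open>alg_power\<close> depends on \<open>scale\<close> only, so it is the same for the
  opposite algebra.\<close>

lemma (in w5_algebra) alg_power_R_alg: "alg_power R_alg 4 = {0}"
proof -
  interpret opp: w5_algebra scale "\<lambda>x y z. op3 z y x"
    using opposite satisfies_w5_opposite[OF w5]
    by (simp add: w5_algebra_def w5_algebra_axioms_def)
  show ?thesis
    using opp.alg_power_L_alg by (simp add: L_alg_opposite)
qed

section \<open>Algebras with nonzero products of multiplications\<close>

definition scale_coeffs :: "'k::field_char_0 \<Rightarrow> ('i \<Rightarrow>\<^sub>0 'k) \<Rightarrow> ('i \<Rightarrow>\<^sub>0 'k)" where
  "scale_coeffs c = Poly_Mapping.map ((*) c)"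

lemma lookup_scale_coeffs [simp]:
  "Poly_Mapping.lookup (scale_coeffs c p) k = c * Poly_Mapping.lookup p k"
  by (simp add: scale_coeffs_def map.rep_eq when_def)

lemma nonzero_if_lookup_nonzero: "Poly_Mapping.lookup p k \<noteq> 0 \<Longrightarrow> p \<noteq> 0"
  by auto

lemma vector_space_scale_coeffs: "vector_space scale_coeffs"
  by unfold_locales (auto intro!: poly_mapping_eqI simp: lookup_add algebra_simps)

lemma linear_scale_coeffs_iff:
  "Vector_Spaces.linear scale_coeffs scale_coeffs f \<longleftrightarrow>
    (\<forall>x y. f (x + y) = f x + f y) \<and> (\<forall>c x. f (scale_coeffs c x) = scale_coeffs c (f x))"
  by (simp add: Vector_Spaces.linear_def module_hom_def module_hom_axioms_def
      module_iff_vector_space vector_space_scale_coeffs)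

text \<open>The free $w_5$-algebra on one generator $a$ has the basis $a$, $b = (aaa)$, $p = (baa)$,
  $q = (aba)$ in degrees up to $5$, where $(aab) = - p - q$. Its part of degree $7$ is replaced by
  the image of a linear functional on the terms of degree $7$ that vanishes on the consequences of
  $w_5$ and takes the value $1$ on the left and right combs $(paa)$ and $(aa(aab))$. The basis
  vectors $a$, $b$, $p$, $q$ and the vector of degree $7$ have the indices $0$ to $4$; the
  other basis vectors of the carrier multiply to zero.\<close>

definition comb_op :: "(nat \<Rightarrow>\<^sub>0 'k::field_char_0) \<Rightarrow> (nat \<Rightarrow>\<^sub>0 'k) \<Rightarrow> (nat \<Rightarrow>\<^sub>0 'k) \<Rightarrow> (nat \<Rightarrow>\<^sub>0 'k)"
  where "comb_op x y z =
    (let X = Poly_Mapping.lookup x; Y = Poly_Mapping.lookup y; Z = Poly_Mapping.lookup z in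
      Poly_Mapping.single 1 (X 0 * Y 0 * Z 0) +
      Poly_Mapping.single 2 (X 1 * Y 0 * Z 0 - X 0 * Y 0 * Z 1) +
      Poly_Mapping.single 3 (X 0 * Y 1 * Z 0 - X 0 * Y 0 * Z 1) +
      Poly_Mapping.single 4 (X 2 * Y 0 * Z 0 - X 0 * Y 0 * Z 2 - X 0 * Y 2 * Z 0
        + 2 * X 0 * Y 3 * Z 0 + X 1 * Y 1 * Z 0 + X 0 * Y 1 * Z 1 - 2 * X 1 * Y 0 * Z 1))"

lemma lookup_comb_op:
  "Poly_Mapping.lookup (comb_op x y z) k =
    (let X = Poly_Mapping.lookup x; Y = Poly_Mapping.lookup y; Z = Poly_Mapping.lookup z in
      if k = 1 then X 0 * Y 0 * Z 0
      else if k = 2 then X 1 * Y 0 * Z 0 - X 0 * Y 0 * Z 1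
      else if k = 3 then X 0 * Y 1 * Z 0 - X 0 * Y 0 * Z 1
      else if k = 4 then X 2 * Y 0 * Z 0 - X 0 * Y 0 * Z 2 - X 0 * Y 2 * Z 0
        + 2 * X 0 * Y 3 * Z 0 + X 1 * Y 1 * Z 0 + X 0 * Y 1 * Z 1 - 2 * X 1 * Y 0 * Z 1
      else 0)"
  by (simp add: comb_op_def Let_def lookup_add lookup_single)

lemma comb_algebra: "ternary_algebra scale_coeffs comb_op"
  unfolding ternary_algebra_def ternary_algebra_axioms_def linear_scale_coeffs_iff
  by (auto intro!: poly_mapping_eqI vector_space_scale_coeffs
      simp: lookup_comb_op Let_def lookup_add algebra_simps)

interpretation comb: ternary_algebra scale_coeffs comb_op
  by (rule comb_algebra)

lemma comb_satisfies_w5: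
  "ternary_algebra.satisfies_w5 (comb_op :: (nat \<Rightarrow>\<^sub>0 'k::field_char_0) \<Rightarrow> _)"
  unfolding comb.satisfies_w5_def comb.w5_def
  by (intro allI poly_mapping_eqI) (simp add: lookup_comb_op Let_def lookup_add algebra_simps)

lemma comb_L_alg:
  "comb.alg_power (comb.L_alg :: ((nat \<Rightarrow>\<^sub>0 'k::field_char_0) \<Rightarrow> _) set) 3 \<noteq> {0}"
proof (rule comb.alg_power_nonzero)
  let ?a = "Poly_Mapping.single 0 1 :: nat \<Rightarrow>\<^sub>0 'k"
  show "set (replicate 3 (comb.lmult ?a ?a)) \<subseteq> comb.L_alg"
    by (auto simp: comb.L_alg_def intro!: comb.generated_subalgebra_incl)
  \<comment> \<open>The value is the right comb: $(aa(aab)) = -(aap) - (aaq)$, with coefficients $1$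
    and $0$.\<close>
  have "Poly_Mapping.lookup (foldr (\<circ>) (replicate 3 (comb.lmult ?a ?a)) id ?a) 4 = 1"
    by (simp add: comb.lmult_def lookup_comb_op Let_def lookup_single when_def numeral_3_eq_3)
  then show "foldr (\<circ>) (replicate 3 (comb.lmult ?a ?a)) id ?a \<noteq> 0"
    by (intro nonzero_if_lookup_nonzero[where k = 4]) simp
qed simp

lemma comb_R_alg:
  "comb.alg_power (comb.R_alg :: ((nat \<Rightarrow>\<^sub>0 'k::field_char_0) \<Rightarrow> _) set) 3 \<noteq> {0}"
proof (rule comb.alg_power_nonzero)
  let ?a = "Poly_Mapping.single 0 1 :: nat \<Rightarrow>\<^sub>0 'k"
  show "set (replicate 3 (comb.rmult ?a ?a)) \<subseteq> comb.R_alg"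
    by (auto simp: comb.R_alg_def intro!: comb.generated_subalgebra_incl)
  \<comment> \<open>The value is the left comb $(paa)$.\<close>
  have "Poly_Mapping.lookup (foldr (\<circ>) (replicate 3 (comb.rmult ?a ?a)) id ?a) 4 = 1"
    by (simp add: comb.rmult_def lookup_comb_op Let_def lookup_single when_def numeral_3_eq_3)
  then show "foldr (\<circ>) (replicate 3 (comb.rmult ?a ?a)) id ?a \<noteq> 0"
    by (intro nonzero_if_lookup_nonzero[where k = 4]) simp
qed simp

text \<open>The index $0$ stands for $a$, the indices $1$ and $2$ for the basis of $V$; the
  other basis vectors multiply to zero.\<close>

definition clifford_op :: "(nat \<Rightarrow>\<^sub>0 'k::field_char_0) \<Rightarrow> (nat \<Rightarrow>\<^sub>0 'k) \<Rightarrow> (nat \<Rightarrow>\<^sub>0 'k) \<Rightarrow> (nat \<Rightarrow>\<^sub>0 'k)"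
  where "clifford_op x y z =
    (let X = Poly_Mapping.lookup x; Y = Poly_Mapping.lookup y; Z = Poly_Mapping.lookup z in
      Poly_Mapping.single 1 (X 0 * Y 0 * Z 2 + X 0 * Y 1 * Z 0) -
      Poly_Mapping.single 2 (X 1 * Y 0 * Z 0 + X 0 * Y 2 * Z 0))"

lemma lookup_clifford_op:
  "Poly_Mapping.lookup (clifford_op x y z) k =
    (let X = Poly_Mapping.lookup x; Y = Poly_Mapping.lookup y; Z = Poly_Mapping.lookup z in
      if k = 1 then X 0 * Y 0 * Z 2 + X 0 * Y 1 * Z 0
      else if k = 2 then - (X 1 * Y 0 * Z 0 + X 0 * Y 2 * Z 0)
      else 0)"
  by (simp add: clifford_op_def Let_def lookup_minus lookup_single)

lemma clifford_algebra: "ternary_algebra scale_coeffs clifford_op"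
  unfolding ternary_algebra_def ternary_algebra_axioms_def linear_scale_coeffs_iff
  by (auto intro!: poly_mapping_eqI vector_space_scale_coeffs
      simp: lookup_clifford_op Let_def lookup_add algebra_simps)

interpretation clifford: ternary_algebra scale_coeffs clifford_op
  by (rule clifford_algebra)

text \<open>Since $(aaa) = 0$, only four arguments $a$ and one in $V$ matter; the five positions of
  the latter give the five relations on $l$, $m$, $r$.\<close>

lemma clifford_satisfies_w5:
  "ternary_algebra.satisfies_w5 (clifford_op :: (nat \<Rightarrow>\<^sub>0 'k::field_char_0) \<Rightarrow> _)"
  unfolding clifford.satisfies_w5_def clifford.w5_def
  by (intro allI poly_mapping_eqI) (simp add: lookup_clifford_op Let_def lookup_add algebra_simps)

lemma clifford_U_alg:
  "clifford.alg_power (clifford.U_alg :: ((nat \<Rightarrow>\<^sub>0 'k::field_char_0) \<Rightarrow> _) set) N \<noteq> {0}"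
proof (rule clifford.alg_power_nonzero)
  let ?a = "Poly_Mapping.single 0 1 :: nat \<Rightarrow>\<^sub>0 'k"
    and ?v = "Poly_Mapping.single 1 1 :: nat \<Rightarrow>\<^sub>0 'k"
  \<comment> \<open>On $V$ this is $lr = -E_{11}$, so \<open>?v\<close> is an eigenvector with
    eigenvalue $-1$.\<close>
  let ?f = "clifford.lmult ?a ?a \<circ> clifford.rmult ?a ?a"
  have "?f \<in> clifford.U_alg"
    unfolding clifford.U_alg_def
    by (intro clifford.generated_subalgebra_comp clifford.generated_subalgebra_incl) blast+
  then show "set (replicate N ?f) \<subseteq> clifford.U_alg"
    by auto
  have "Poly_Mapping.lookup (foldr (\<circ>) (replicate N ?f) id ?v) 1 = (- 1) ^ N"
    by (induction N) (simp_all add: clifford.lmult_def clifford.rmult_def lookup_clifford_op Let_def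
        lookup_single lookup_one when_def)
  then show "foldr (\<circ>) (replicate N ?f) id ?v \<noteq> 0"
    by (intro nonzero_if_lookup_nonzero[where k = 1]) simp
qed simp

theorem theorem2:
  shows
   "(\<forall>(scale :: 'k::field_char_0 \<Rightarrow> 'a::ab_group_add \<Rightarrow> 'a) op3.
       ternary_algebra scale op3 \<and> ternary_algebra.satisfies_w5 op3 \<longrightarrow>
         ternary_algebra.alg_power scale (ternary_algebra.L_alg scale op3) 4 = {0} \<and>
         ternary_algebra.alg_power scale (ternary_algebra.R_alg scale op3) 4 = {0}) \<and>
    (\<exists>(scale :: 'k \<Rightarrow> (nat \<Rightarrow>\<^sub>0 'k) \<Rightarrow> (nat \<Rightarrow>\<^sub>0 'k)) op3.
       ternary_algebra scale op3 \<and> ternary_algebra.satisfies_w5 op3 \<and>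
         ternary_algebra.alg_power scale (ternary_algebra.L_alg scale op3) 3 \<noteq> {0}) \<and>
    (\<exists>(scale :: 'k \<Rightarrow> (nat \<Rightarrow>\<^sub>0 'k) \<Rightarrow> (nat \<Rightarrow>\<^sub>0 'k)) op3.
       ternary_algebra scale op3 \<and> ternary_algebra.satisfies_w5 op3 \<and>
         ternary_algebra.alg_power scale (ternary_algebra.R_alg scale op3) 3 \<noteq> {0}) \<and>
    (\<exists>(scale :: 'k \<Rightarrow> (nat \<Rightarrow>\<^sub>0 'k) \<Rightarrow> (nat \<Rightarrow>\<^sub>0 'k)) op3.
       ternary_algebra scale op3 \<and> ternary_algebra.satisfies_w5 op3 \<and>
         (\<forall>N\<ge>1. ternary_algebra.alg_power scale (ternary_algebra.U_alg scale op3) N \<noteq> {0}))"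
proof (intro conjI allI impI)
  fix scale :: "'k \<Rightarrow> 'a \<Rightarrow> 'a" and op3
  assume "ternary_algebra scale op3 \<and> ternary_algebra.satisfies_w5 op3"
  then interpret w5_algebra scale op3
    by (simp add: w5_algebra_def w5_algebra_axioms_def)
  show "alg_power L_alg 4 = {0}" "alg_power R_alg 4 = {0}"
    by (rule alg_power_L_alg, rule alg_power_R_alg)
qed (use comb_algebra comb_satisfies_w5 comb_L_alg comb_R_alg
  clifford_algebra clifford_satisfies_w5 clifford_U_alg in blast)+

end
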